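(* Let $\mathcal{G}$ be a geometric algebra, and let $A_r$ and $B_s$ be a nonzero $r$-blade and a nonzero $s$-blade in $\mathcal{G}$, where $r,s\ge 1$. (a) $A_r\rfloor B_s=0$ if and only if the subspace represented by $A_r$ contains a nonzero vector orthogonal to every vector of the subspace represented by $B_s$. (b) If $r<s$ and $A_r\rfloor B_s$ is nonzero, then $A_r\rfloor B_s$ is an $(s-r)$-blade representing the orthogonal complement of $A_r$ in $B_s$.
   Context: A geometric algebra $\mathcal{G}$ is a ring with unit containing a field $\mathcal{G}_0$ of characteristic zero (the scalars, with $0,1\in\mathcal{G}_0$) and a subset $\mathcal{G}_1$ (the vectors) closed under addition with $\lambda v=v\lambda\in\mathcal{G}_1$ for all $\lambda\in\mathcal{G}_0$, $v\in\mathcal{G}_1$ (so $\mathcal{G}_1$ is a $\mathcal{G}_0$-vector space), such that: the square of every vector is a scalar; the symmetric bilinear inner product of vectors $u\rfloor v=\frac12(uv+vu)\in\mathcal{G}_0$ is nondegenerate (the only vector orthogonal to all vectors is $0$); and $\mathcal{G}$ is the direct sum of the subspaces $\mathcal{G}_r$, $r\ge 0$, defined as follows. Vectors $u,v$ are orthogonal if $u\rfloor v=0$. For $r\ge 2$ an $r$-blade is a product of $r$ pairwise orthogonal vectors; $0$-blades are the scalars and $1$-blades the vectors. An $r$-vector is a finite sum of $r$-blades, and $\mathcal{G}_r$ is the set of $r$-vectors. $\langle A\rangle_r$ denotes the component of $A\in\mathcal{G}$ in $\mathcal{G}_r$, with $\langle A\rangle_r=0$ for $r<0$. For $A=\sum_rA_r$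 and $B=\sum_sB_s$ with $A_r\in\mathcal{G}_r$, $B_s\in\mathcal{G}_s$, the left inner and outer products are $A\rfloor B:=\sum_{r,s}\langle A_rB_s\rangle_{s-r}$ and $A\wedge B:=\sum_{r,s}\langle A_rB_s\rangle_{r+s}$ (the left inner product extends the inner product of vectors). A nonzero $r$-blade $A_r$ with $r\ge 1$ represents the $r$-dimensional subspace $\{a\in\mathcal{G}_1: a\wedge A_r=0\}$, the span of the vectors in any expression of $A_r$ as an outer product of $r$ vectors. The orthogonal complement of $A_r$ in $B_s$ is the set of all vectors lying in the subspace represented by $B_s$ that are orthogonal to every vector of the subspace represented by $A_r$. *)

theory Defs
  imports Main
begin

text \<open>
  The ambient ring is a type of class \<open>ring_1\<close>; \<open>G0\<close> is its set of scalars and \<open>G1\<close> its set of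
  vectors. The notions below are plain functions of \<open>G0\<close> and \<open>G1\<close>, because the axiom that the
  algebra is the direct sum of its homogeneous parts already refers to blades.
\<close>

definition half :: "'a::ring_1 set \<Rightarrow> 'a" where
  "half G0 = (THE h. h \<in> G0 \<and> 2 * h = 1)"

definition vec_inner :: "'a::ring_1 set \<Rightarrow> 'a \<Rightarrow> 'a \<Rightarrow> 'a" where
  "vec_inner G0 u v = half G0 * (u * v + v * u)"

definition orthogonal_vecs :: "'a::ring_1 set \<Rightarrow> 'a \<Rightarrow> 'a \<Rightarrow> bool" where
  "orthogonal_vecs G0 u v \<longleftrightarrow> vec_inner G0 u v = 0"

text \<open>
  Pairwise orthogonality concerns distinct positions, so a list may repeat a null vector; the
  product is then zero. In particular \<open>0\<close> is an \<open>r\<close>-blade for every \<open>r\<close>.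
\<close>

definition blades :: "'a::ring_1 set \<Rightarrow> 'a set \<Rightarrow> nat \<Rightarrow> 'a set" where
  "blades G0 G1 r =
    (if r = 0 then G0
     else if r = 1 then G1
     else {prod_list vs | vs. length vs = r \<and> set vs \<subseteq> G1 \<and>
            (\<forall>i<r. \<forall>j<r. i \<noteq> j \<longrightarrow> orthogonal_vecs G0 (vs ! i) (vs ! j))})"

definition rvectors :: "'a::ring_1 set \<Rightarrow> 'a set \<Rightarrow> nat \<Rightarrow> 'a set" where
  "rvectors G0 G1 r = {sum_list bs | bs. set bs \<subseteq> blades G0 G1 r}"

definition grade_decomp :: "'a::ring_1 set \<Rightarrow> 'a set \<Rightarrow> 'a \<Rightarrow> (nat \<Rightarrow> 'a) \<Rightarrow> bool" where
  "grade_decomp G0 G1 A f \<longleftrightarrow>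
    (\<forall>r. f r \<in> rvectors G0 G1 r) \<and> finite {r. f r \<noteq> 0} \<and> A = (\<Sum>r | f r \<noteq> 0. f r)"

locale geometric_algebra =
  fixes G0 G1 :: "'a::ring_1 set"
  assumes zero_scalar: "0 \<in> G0"
    and one_scalar: "1 \<in> G0"
    and add_scalar: "x \<in> G0 \<Longrightarrow> y \<in> G0 \<Longrightarrow> x + y \<in> G0"
    and uminus_scalar: "x \<in> G0 \<Longrightarrow> - x \<in> G0"
    and mult_scalar: "x \<in> G0 \<Longrightarrow> y \<in> G0 \<Longrightarrow> x * y \<in> G0"
    and commute_scalar: "x \<in> G0 \<Longrightarrow> y \<in> G0 \<Longrightarrow> x * y = y * x"
    and inverse_scalar: "x \<in> G0 \<Longrightarrow> x \<noteq> 0 \<Longrightarrow> \<exists>y\<in>G0. x * y = 1"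
    and char_zero: "n > 0 \<Longrightarrow> of_nat n \<noteq> (0::'a)"
    and zero_vector: "0 \<in> G1"
    and add_vector: "u \<in> G1 \<Longrightarrow> v \<in> G1 \<Longrightarrow> u + v \<in> G1"
    and scale_vector: "x \<in> G0 \<Longrightarrow> v \<in> G1 \<Longrightarrow> x * v \<in> G1"
    and scale_commute: "x \<in> G0 \<Longrightarrow> v \<in> G1 \<Longrightarrow> x * v = v * x"
    and square_scalar: "v \<in> G1 \<Longrightarrow> v * v \<in> G0"
    and nondegenerate: "u \<in> G1 \<Longrightarrow> (\<And>v. v \<in> G1 \<Longrightarrow> orthogonal_vecs G0 u v) \<Longrightarrow> u = 0"
    and direct_sum: "\<exists>!f. grade_decomp G0 G1 A f"

definition homogeneous_part :: "'a::ring_1 set \<Rightarrow> 'a set \<Rightarrow> 'a \<Rightarrow> nat \<Rightarrow> 'a" where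
  "homogeneous_part G0 G1 A = (THE f. grade_decomp G0 G1 A f)"

definition grade_part :: "'a::ring_1 set \<Rightarrow> 'a set \<Rightarrow> 'a \<Rightarrow> int \<Rightarrow> 'a" where
  "grade_part G0 G1 A k = (if k < 0 then 0 else homogeneous_part G0 G1 A (nat k))"

text \<open>
  The sums run over the finitely many nonzero homogeneous parts of \<open>A\<close> and \<open>B\<close>.
\<close>

definition left_inner :: "'a::ring_1 set \<Rightarrow> 'a set \<Rightarrow> 'a \<Rightarrow> 'a \<Rightarrow> 'a" where
  "left_inner G0 G1 A B =
    (\<Sum>r | homogeneous_part G0 G1 A r \<noteq> 0. \<Sum>s | homogeneous_part G0 G1 B s \<noteq> 0.
      grade_part G0 G1 (homogeneous_part G0 G1 A r * homogeneous_part G0 G1 B s) (int s - int r))"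

definition outer :: "'a::ring_1 set \<Rightarrow> 'a set \<Rightarrow> 'a \<Rightarrow> 'a \<Rightarrow> 'a" where
  "outer G0 G1 A B =
    (\<Sum>r | homogeneous_part G0 G1 A r \<noteq> 0. \<Sum>s | homogeneous_part G0 G1 B s \<noteq> 0.
      grade_part G0 G1 (homogeneous_part G0 G1 A r * homogeneous_part G0 G1 B s) (int r + int s))"

definition represented_subspace :: "'a::ring_1 set \<Rightarrow> 'a set \<Rightarrow> 'a \<Rightarrow> 'a set" where
  "represented_subspace G0 G1 A = {a \<in> G1. outer G0 G1 a A = 0}"

definition orth_complement_in :: "'a::ring_1 set \<Rightarrow> 'a set \<Rightarrow> 'a \<Rightarrow> 'a \<Rightarrow> 'a set" where
  "orth_complement_in G0 G1 A B =
    {v \<in> represented_subspace G0 G1 B. \<forall>a\<in>represented_subspace G0 G1 A. orthogonal_vecs G0 v a}"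

end

(*
  The outer product of vectors a_1, ..., a_r (up to the factor 2^r) is the iterated graded
  anticommutator; it is alternating and multilinear, so orthogonalizing the a_i by shears shows
  that it is an r-blade, and nondegeneracy shows that it vanishes exactly when the a_i are
  dependent.  For a vector b and a blade B one has b B = contraction + b wedge B.  If b is
  orthogonal to B, the contraction is 0; otherwise a basis of the space of B with a single vector
  not orthogonal to b exhibits the contraction as a nonzero blade representing the part of that space
  orthogonal to b.  Multiplying B by the orthogonal factors of A one at a time and keeping the
  lowest possible grade gives A left-inner B.  It breaks down at the first factor that is orthogonal
  to what is left of B; by finite-dimensional duality this happens exactly when some nonzero
  vector of the space of A is orthogonal to all of B.
*)

theory Submission
  imports Defs
begin

section \<open>Anticommutators and scaled outer products in an arbitrary ring\<close>

definition anticomm :: "'a::ring_1 \<Rightarrow> 'a \<Rightarrow> 'a" where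
  "anticomm u v = u * v + v * u"

definition perp :: "'a::ring_1 list \<Rightarrow> 'a set" where
  "perp l = {z. \<forall>y\<in>set l. anticomm z y = 0}"

text \<open>
  The outer product of a list of \<open>n\<close> vectors, scaled by \<open>2 ^ n\<close> so that the scalar \<open>1/2\<close>
  stays out of the ring identities.
\<close>

fun wedge :: "'a::ring_1 list \<Rightarrow> 'a" where
  "wedge [] = 1"
| "wedge (a # l) = a * wedge l + (-1) ^ length l * wedge l * a"

lemma anticomm_commute: "anticomm u v = anticomm v u"
  by (simp add: anticomm_def add.commute)

lemma anticomm_add_left: "anticomm (u + v) w = anticomm u w + anticomm v w"
  and anticomm_add_right: "anticomm w (u + v) = anticomm w u + anticomm w v"
  by (simp_all add: anticomm_def algebra_simps)

lemma anticomm_diff_right: "anticomm w (u - v) = anticomm w u - anticomm w v"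
  by (simp add: anticomm_def algebra_simps)

lemma sign_cases: "(-1) ^ n = (1::'a::ring_1) \<or> (-1) ^ n = (-1::'a)"
  by (cases "even n") auto

lemma wedge_add: "wedge ((a + b) # l) = wedge (a # l) + wedge (b # l)"
  by (simp add: algebra_simps)

lemma wedge_diff: "wedge ((a - b) # l) = wedge (a # l) - wedge (b # l)"
  by (simp add: algebra_simps)

lemma wedge_Cons_cong: "length l = length l' \<Longrightarrow> wedge l = wedge l' \<Longrightarrow> wedge (a # l) = wedge (a # l')"
  by simp

lemma perpD: "z \<in> perp l \<Longrightarrow> y \<in> set l \<Longrightarrow> anticomm z y = 0"
  by (simp add: perp_def)

lemma perp_Nil [simp]: "perp [] = UNIV"
  by (simp add: perp_def)

lemma perp_Cons [simp]: "z \<in> perp (a # l) \<longleftrightarrow> anticomm z a = 0 \<and> z \<in> perp l"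
  by (auto simp: perp_def)

text \<open>Moving \<open>x\<close> past one factor costs one sign. This applies to both terms of
  the recursion for \<open>wedge\<close>, since each contains every factor of \<open>m\<close>
  once.\<close>

lemma orthogonal_mult_wedge:
  assumes "x \<in> perp m"
  shows "x * wedge m = (-1) ^ length m * wedge m * x"
  using assms
proof (induction m)
  case (Cons c m)
  have cx: "x * c = - (c * x)"
    using Cons.prems by (simp add: anticomm_def eq_neg_iff_add_eq_0)
  have IH: "x * wedge m = (-1) ^ length m * wedge m * x"
    using Cons by simp
  have *: "x * (c * wedge m) = - (c * (x * wedge m))"
    by (metis cx mult.assoc mult_minus_left)
  have **: "x * (wedge m * c) = (-1) ^ length m * wedge m * x * c"
    by (metis IH mult.assoc)
  have ***: "(-1) ^ length m * wedge m * x * c = - ((-1) ^ length m * wedge m * c * x)"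
    by (metis cx mult.assoc mult_minus_right)
  show ?case
    using sign_cases[of "length m", where 'a = 'a]
    by (elim disjE; use IH * ** *** in \<open>simp add: algebra_simps\<close>)
qed simp

corollary wedge_orthogonal_Cons:
  assumes "x \<in> perp m"
  shows "wedge (x # m) = 2 * (x * wedge m)"
  using orthogonal_mult_wedge[OF assms] by (simp add: mult_2)

text \<open>For orthogonal factors the two terms of the recursion coincide, so each factor
  contributes a 2. \<open>sorted_wrt\<close> encodes pairwise orthogonality in a form suited to list
  induction.\<close>

lemma wedge_eq_prod_list:
  assumes "sorted_wrt (\<lambda>u v. anticomm u v = 0) l"
  shows "wedge l = 2 ^ length l * prod_list l"
  using assms
proof (induction l)
  case (Cons a l)
  have "a * 2 ^ length l = 2 ^ length l * a"
    by (metis mult_of_nat_commute of_nat_numeral of_nat_power)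
  with Cons show ?case
    using wedge_orthogonal_Cons[of a l] by (simp del: wedge.simps add: perp_def mult.assoc[symmetric])
qed simp

fun list_span :: "'a::ring_1 set \<Rightarrow> 'a list \<Rightarrow> 'a set" where
  "list_span K [] = {0}"
| "list_span K (a # l) = {k * a + x | k x. k \<in> K \<and> x \<in> list_span K l}"

context geometric_algebra
begin

section \<open>Scalars, division by two, and the bilinear form\<close>

abbreviation "hp \<equiv> homogeneous_part G0 G1"
abbreviation "rvecs \<equiv> rvectors G0 G1"

lemma grade_decomp_hp: "grade_decomp G0 G1 A (hp A)"
  unfolding homogeneous_part_def by (rule theI'[OF direct_sum])

lemma hp_eqI: "grade_decomp G0 G1 A f \<Longrightarrow> hp A = f"
  using direct_sum grade_decomp_hp by blast

lemma hp_in_rvecs: "hp A r \<in> rvecs r"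
  and finite_hp: "finite {r. hp A r \<noteq> 0}"
  and sum_hp: "(\<Sum>r | hp A r \<noteq> 0. hp A r) = A"
  using grade_decomp_hp[of A] by (auto simp: grade_decomp_def)

text \<open>Scalars are only assumed to commute with scalars and vectors. The grade decomposition
  writes any ring element as a sum of products of these, so scalars are central.\<close>

lemma scalar_commute:
  assumes "x \<in> G0" shows "y * x = x * y"
proof -
  have prod: "prod_list vs * x = x * prod_list vs" if "set vs \<subseteq> G1" for vs
    using that
  proof (induction vs)
    case (Cons v vs)
    then show ?case
      using scale_commute[OF assms, of v] by (simp add: mult.assoc) (simp add: mult.assoc[symmetric])
  qed simp
  have blade: "b * x = x * b" if "b \<in> blades G0 G1 r" for b r
    using that prod commute_scalar[OF assms, of b] scale_commute[OF assms, of b]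
    by (auto simp: blades_def split: if_splits)
  have "sum_list bs * x = x * sum_list bs" if "set bs \<subseteq> blades G0 G1 r" for bs r
    using that by (induction bs) (auto simp: algebra_simps blade)
  then have "hp y r * x = x * hp y r" for r
    using hp_in_rvecs[of y r] by (auto simp: rvectors_def)
  then have "(\<Sum>r | hp y r \<noteq> 0. hp y r) * x = x * (\<Sum>r | hp y r \<noteq> 0. hp y r)"
    by (simp add: sum_distrib_left sum_distrib_right)
  then show ?thesis by (simp add: sum_hp)
qed

lemma scalar_left_commute: "x \<in> G0 \<Longrightarrow> y * (x * z) = x * (y * z)"
  by (metis mult.assoc scalar_commute)

lemma scalar_no_zero_div: "x \<in> G0 \<Longrightarrow> x \<noteq> 0 \<Longrightarrow> x * y = 0 \<Longrightarrow> y = 0"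
  by (metis inverse_scalar mult.assoc mult_1 mult_zero_right scalar_commute)

lemma two_nonzero: "(2::'a) \<noteq> 0"
  using char_zero[of 2] by simp

lemma two_scalar: "2 \<in> G0"
  using add_scalar[OF one_scalar one_scalar] by simp

lemma half_scalar: "half G0 \<in> G0" and two_half: "2 * half G0 = 1"
proof -
  obtain h where h: "h \<in> G0" "2 * h = 1"
    using inverse_scalar[OF two_scalar two_nonzero] by blast
  have "half G0 = h"
    unfolding half_def using h
    by (intro the_equality) (auto, metis mult.assoc mult_1_left mult_1_right scalar_commute)
  with h show "half G0 \<in> G0" "2 * half G0 = 1" by simp_all
qed

lemma half_two: "half G0 * (2 * x) = x"
  by (metis mult.assoc mult_1 scalar_commute two_half two_scalar)

lemma half_nonzero: "half G0 \<noteq> 0"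
  using two_half by auto

lemma double_eq_0: "x + x = 0 \<Longrightarrow> x = (0::'a)"
  using scalar_no_zero_div[OF two_scalar two_nonzero, of x] by (simp add: mult_2)

lemma orthogonal_iff: "orthogonal_vecs G0 u v \<longleftrightarrow> anticomm u v = 0"
  using scalar_no_zero_div[OF half_scalar half_nonzero]
  by (auto simp: orthogonal_vecs_def vec_inner_def anticomm_def)

lemma diff_scalar: "x \<in> G0 \<Longrightarrow> y \<in> G0 \<Longrightarrow> x - y \<in> G0"
  using add_scalar[of x "- y"] uminus_scalar by simp

lemma sign_scalar: "(-1) ^ n \<in> G0"
  using sign_cases[of n, where 'a = 'a] one_scalar uminus_scalar by metis

lemma uminus_vector: "v \<in> G1 \<Longrightarrow> - v \<in> G1"
  using scale_vector[OF uminus_scalar[OF one_scalar]] by simp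

lemma diff_vector: "u \<in> G1 \<Longrightarrow> v \<in> G1 \<Longrightarrow> u - v \<in> G1"
  using add_vector[of u "- v"] uminus_vector by simp

text \<open>Polarization of the axiom that squares of vectors are scalars.\<close>

lemma anticomm_scalar:
  assumes "u \<in> G1" "v \<in> G1" shows "anticomm u v \<in> G0"
proof -
  have "anticomm u v = (u + v) * (u + v) - u * u - v * v"
    by (simp add: anticomm_def algebra_simps)
  then show ?thesis
    using assms by (simp add: diff_scalar square_scalar add_vector)
qed

lemma anticomm_scale_left: "x \<in> G0 \<Longrightarrow> anticomm (x * u) v = x * anticomm u v"
  and anticomm_scale_right: "x \<in> G0 \<Longrightarrow> anticomm u (x * v) = x * anticomm u v"
  by (simp_all add: anticomm_def algebra_simps scalar_left_commute[of x u] scalar_left_commute[of x v])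

lemma wedge_scale: "x \<in> G0 \<Longrightarrow> wedge ((x * a) # l) = x * wedge (a # l)"
  by (simp add: algebra_simps scalar_left_commute[of x "(-1) ^ length l"] scalar_left_commute[of x "wedge l"])

lemma wedge_Cons_scale:
  "x \<in> G0 \<Longrightarrow> length l = length l' \<Longrightarrow> wedge l = x * wedge l' \<Longrightarrow> wedge (a # l) = x * wedge (a # l')"
  by (simp add: algebra_simps scalar_left_commute[of x a] scalar_left_commute[of x "(-1) ^ length l'"])

section \<open>The outer product is alternating\<close>

text \<open>The sum of the two sides collapses to the commutator of \<open>wedge l\<close> with
  \<open>anticomm a b\<close>, which is a scalar and hence central.\<close>

lemma wedge_swap:
  assumes "a \<in> G1" "b \<in> G1"
  shows "wedge (a # b # l) = - wedge (b # a # l)"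
proof -
  have *: "wedge l * anticomm a b = anticomm a b * wedge l"
    by (rule scalar_commute) (rule anticomm_scalar[OF assms])
  show ?thesis
    using sign_cases[of "length l", where 'a = 'a]
  proof
    assume s: "(-1) ^ length l = (1::'a)"
    have "wedge (a # b # l) + wedge (b # a # l) = anticomm a b * wedge l - wedge l * anticomm a b"
      by (simp add: s anticomm_def algebra_simps)
    with * show ?thesis by (simp del: wedge.simps add: eq_neg_iff_add_eq_0)
  next
    assume s: "(-1) ^ length l = (-1::'a)"
    have "wedge (a # b # l) + wedge (b # a # l) = anticomm a b * wedge l - wedge l * anticomm a b"
      by (simp add: s anticomm_def algebra_simps)
    with * show ?thesis by (simp del: wedge.simps add: eq_neg_iff_add_eq_0)
  qed
qed

lemma wedge_repeat: "a \<in> G1 \<Longrightarrow> wedge (a # a # l) = 0"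
  using wedge_swap[of a a l] double_eq_0 by (metis eq_neg_iff_add_eq_0)

lemma wedge_move_front:
  assumes "set xs \<subseteq> G1" "c \<in> G1"
  shows "wedge (xs @ c # ys) = (-1) ^ length xs * wedge (c # xs @ ys)"
  using assms
proof (induction xs)
  case (Cons x xs)
  have "wedge (x # xs @ c # ys) = (-1) ^ length xs * wedge (x # c # xs @ ys)"
    by (rule wedge_Cons_scale[OF sign_scalar]) (use Cons in auto)
  then show ?case
    using Cons.prems wedge_swap[of x c "xs @ ys"] by (simp del: wedge.simps)
qed simp

text \<open>Shears along \<open>c\<close> preserve the outer product. In the induction
  \<open>c\<close> is swapped behind the first sheared vector, the tail is handled under it, and the
  extra multiple of \<open>c\<close> then meets another \<open>c\<close> and vanishes.\<close>

lemma wedge_transvection: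
  assumes "c \<in> G1" "set l \<subseteq> G1" "\<And>y. y \<in> set l \<Longrightarrow> f y \<in> G0"
  shows "wedge (c # map (\<lambda>y. y - f y * c) l) = wedge (c # l)"
  using assms
proof (induction l)
  case (Cons y l)
  let ?l = "map (\<lambda>y. y - f y * c) l" and ?y = "y - f y * c"
  have y: "y \<in> G1" "?y \<in> G1"
    using Cons.prems by (auto intro!: diff_vector scale_vector)
  have "wedge (c # ?y # ?l) = - wedge (?y # c # ?l)"
    using y Cons.prems(1) by (intro wedge_swap) auto
  also have "wedge (?y # c # ?l) = wedge (?y # c # l)"
    by (rule wedge_Cons_cong) (use Cons in auto)
  also have "\<dots> = wedge (y # c # l) - f y * wedge (c # c # l)"
    using Cons.prems by (simp del: wedge.simps add: wedge_diff wedge_scale)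
  also have "\<dots> = - wedge (c # y # l)"
    using Cons.prems y wedge_swap[of y c l] by (simp del: wedge.simps add: wedge_repeat)
  finally show ?case by simp
qed simp

lemma wedge_member: "d \<in> set l \<Longrightarrow> set l \<subseteq> G1 \<Longrightarrow> wedge (d # l) = 0"
proof -
  assume d: "d \<in> set l" "set l \<subseteq> G1"
  then obtain xs ys where l: "l = xs @ d # ys" by (meson split_list)
  have "wedge (d # l) = (-1) ^ length xs * wedge (d # d # xs @ ys)"
    unfolding l by (rule wedge_Cons_scale[OF sign_scalar]) (use d l wedge_move_front[of xs d ys] in auto)
  with d show ?thesis by (auto simp del: wedge.simps simp: wedge_repeat subset_iff)
qed

section \<open>Contraction by a vector and orthogonalization\<close>

text \<open>The splitting of a product into outer part and contraction, when \<open>c\<close> is the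
  only factor that \<open>x\<close> may fail to be orthogonal to.\<close>

lemma wedge_contract:
  assumes "x \<in> G1" "c \<in> G1" "x \<in> perp m"
  shows "2 * (x * wedge (c # m)) = wedge (x # c # m) + 2 * anticomm x c * wedge m"
proof -
  have o: "x * wedge m = (-1) ^ length m * wedge m * x"
    by (rule orthogonal_mult_wedge) fact
  have *: "wedge m * anticomm x c = anticomm x c * wedge m"
    by (rule scalar_commute) (rule anticomm_scalar[OF assms(1,2)])
  \<comment> \<open>What remains is the graded commutator of \<open>x\<close> with
    \<open>wedge (c # m)\<close>. Moving \<open>x\<close> through \<open>wedge m\<close> pairs it
    with \<open>c\<close> in both terms.\<close>
  have k: "2 * (x * wedge (c # m)) - wedge (x # c # m)
      = x * wedge (c # m) + (-1) ^ length m * wedge (c # m) * x"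
    by (simp add: mult_2 algebra_simps)
  have "\<dots> = anticomm x c * wedge m + wedge m * anticomm x c"
    using sign_cases[of "length m", where 'a = 'a]
  proof
    assume s: "(-1) ^ length m = (1::'a)"
    then have "x * (wedge m * c) = wedge m * (x * c)" "c * (wedge m * x) = c * (x * wedge m)"
      using o by (simp_all add: mult.assoc[symmetric])
    then show ?thesis by (simp add: s anticomm_def algebra_simps)
  next
    assume s: "(-1) ^ length m = (-1::'a)"
    then have "x * (wedge m * c) = - (wedge m * (x * c))" "c * (wedge m * x) = - (c * (x * wedge m))"
      using o by (simp_all add: mult.assoc[symmetric])
    then show ?thesis by (simp add: s anticomm_def algebra_simps)
  qed
  then have "2 * (x * wedge (c # m)) - wedge (x # c # m) = 2 * anticomm x c * wedge m"
    unfolding k * by (simp only: mult_2 distrib_right)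
  then show ?thesis by (simp del: wedge.simps add: diff_eq_eq add.commute)
qed

text \<open>Move \<open>c\<close> to the front, which gives the sign \<open>e\<close>, and shear the
  other vectors along \<open>c\<close> until they are orthogonal to \<open>x\<close>. The sheared
  vectors are combinations of vectors of \<open>m\<close>, whence the inclusion of
  \<open>perp m\<close>.\<close>

lemma wedge_adapt:
  assumes "x \<in> G1" "set m \<subseteq> G1" "c \<in> set m" "anticomm x c \<noteq> 0"
  obtains m1 e where "e \<in> G0" "e \<noteq> 0" "set m1 \<subseteq> G1" "length m = Suc (length m1)"
    "x \<in> perp m1" "perp m \<subseteq> perp m1" "wedge m = e * wedge (c # m1)"
proof -
  obtain xs ys where m: "m = xs @ c # ys" using assms(3) by (meson split_list)
  have c: "c \<in> G1" using assms by auto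
  obtain i where i: "i \<in> G0" "anticomm x c * i = 1"
    using inverse_scalar[OF anticomm_scalar[OF assms(1) c] assms(4)] by blast
  \<comment> \<open>The coefficient for which \<open>y - f y * c\<close> is orthogonal to
    \<open>x\<close>.\<close>
  define f where "f y = i * anticomm x y" for y
  define m1 where "m1 = map (\<lambda>y. y - f y * c) (xs @ ys)"
  have sub: "set (xs @ ys) \<subseteq> G1" using assms(2) m by auto
  have f: "f y \<in> G0" if "y \<in> set (xs @ ys)" for y
    unfolding f_def using i sub that assms(1) by (intro mult_scalar anticomm_scalar) auto
  have ic: "i * anticomm x y * anticomm x c = anticomm x y" for y
    by (metis i mult.assoc mult_1_right scalar_commute)
  show ?thesis
  proof
    show "(-1) ^ length xs \<in> G0" by (rule sign_scalar)
    show "(-1::'a) ^ length xs \<noteq> 0"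
      using sign_cases[of "length xs", where 'a = 'a] by auto
    show "set m1 \<subseteq> G1"
      unfolding m1_def set_map using sub f c diff_vector scale_vector by blast
    show "length m = Suc (length m1)" by (simp add: m m1_def)
    show "x \<in> perp m1"
      unfolding m1_def perp_def set_map using f
      by (simp add: anticomm_diff_right anticomm_scale_right del: set_append) (simp add: f_def ic)
    show "perp m \<subseteq> perp m1"
      unfolding m1_def perp_def set_map using f
      by (auto simp add: anticomm_diff_right anticomm_scale_right m)
    show "wedge m = (-1) ^ length xs * wedge (c # m1)"
    proof -
      have "wedge (c # m1) = wedge (c # xs @ ys)"
        unfolding m1_def by (rule wedge_transvection[OF c sub f])
      moreover have "set xs \<subseteq> G1" using sub by simp
      ultimately show ?thesis
        unfolding m using wedge_move_front[OF _ c, of xs ys] by simp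
    qed
  qed
qed

text \<open>Gram-Schmidt for a form that may be degenerate on the span: split off a non-null vector
  and recurse on the rest. The inclusion of \<open>perp l\<close> in \<open>perp e\<close> keeps
  earlier pivots orthogonal to whatever the recursion produces.\<close>

lemma wedge_orthogonalize:
  assumes "set l \<subseteq> G1"
  obtains e c where "c \<in> G0" "set e \<subseteq> G1" "length e = length l"
    "sorted_wrt (\<lambda>u v. anticomm u v = 0) e" "wedge l = c * wedge e" "perp l \<subseteq> perp e"
proof -
  let ?P = "\<lambda>l. \<exists>e c. c \<in> G0 \<and> set e \<subseteq> G1 \<and> length e = length l \<and>
    sorted_wrt (\<lambda>u v. anticomm u v = 0) e \<and> wedge l = c * wedge e \<and> perp l \<subseteq> perp e"
  have "?P l"
    using assms
  proof (induction "length l" arbitrary: l)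
    case 0
    then show ?case using one_scalar by (intro exI[of _ "[]"] exI[of _ 1]) auto
  next
    case (Suc n)
    \<comment> \<open>Stated for any list of this length, because the pivot may have to be a vector
      that is not in \<open>l\<close>.\<close>
    have pivot: "?P k" if k: "length k = Suc n" "set k \<subseteq> G1" "c \<in> set k" "anticomm c c \<noteq> 0" for k c
    proof -
      have c: "c \<in> G1" using k by auto
      obtain m1 e where m1: "e \<in> G0" "set m1 \<subseteq> G1" "length k = Suc (length m1)"
        "c \<in> perp m1" "perp k \<subseteq> perp m1" "wedge k = e * wedge (c # m1)"
        using wedge_adapt[OF c k(2-4)] by metis
      have "?P m1"
        using Suc.hyps(1)[of m1] m1 k(1) by simp
      then obtain o1 d where o1: "d \<in> G0" "set o1 \<subseteq> G1" "length o1 = length m1"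
        "sorted_wrt (\<lambda>u v. anticomm u v = 0) o1" "wedge m1 = d * wedge o1" "perp m1 \<subseteq> perp o1"
        by blast
      have "wedge (c # m1) = d * wedge (c # o1)"
        using o1 by (intro wedge_Cons_scale) auto
      then have "wedge k = (e * d) * wedge (c # o1)"
        using m1(6) by (simp add: mult.assoc del: wedge.simps)
      moreover have "perp k \<subseteq> perp (c # o1)"
        using m1(5) o1(6) k(3) by (simp add: subset_iff perpD)
      moreover have "sorted_wrt (\<lambda>u v. anticomm u v = 0) (c # o1)"
        using m1(4) o1(4,6) by (auto simp: perp_def)
      ultimately show ?thesis
        using m1(1,3) o1(1-3) c mult_scalar
        by (intro exI[of _ "c # o1"] exI[of _ "e * d"] conjI) simp_all
    qed
    show ?case
    proof (cases "\<exists>c\<in>set l. anticomm c c \<noteq> 0")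
      case True
      then obtain c where "c \<in> set l" "anticomm c c \<noteq> 0" by blast
      with pivot[of l c] Suc.hyps(2) Suc.prems show ?thesis by simp
    next
      case False
      show ?thesis
      proof (cases "sorted_wrt (\<lambda>u v. anticomm u v = 0) l")
        case True
        then show ?thesis using Suc.prems one_scalar by (intro exI[of _ l] exI[of _ 1]) simp
      next
        case nsorted: False
        \<comment> \<open>All vectors are null, but two of them are not orthogonal. Their sum is
          then non-null and can replace \<open>c\<close>, since the added \<open>d\<close> still
          occurs among the other factors.\<close>
        then obtain i j where ij: "i < j" "j < length l" "anticomm (l ! i) (l ! j) \<noteq> 0"
          by (auto simp: sorted_wrt_iff_nth_less)
        define c d where "c = l ! i" and "d = l ! j"
        have cd: "c \<in> set l" "d \<in> set l" "anticomm c d \<noteq> 0"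
          using ij by (auto simp: c_def d_def)
        then have "c \<noteq> d" using False by auto
        obtain xs ys where l: "l = xs @ c # ys" using cd(1) by (meson split_list)
        let ?k = "(c + d) # xs @ ys"
        have d: "d \<in> set (xs @ ys)" using cd l \<open>c \<noteq> d\<close> by auto
        have sub: "set (xs @ ys) \<subseteq> G1" "c \<in> G1" "d \<in> G1" using Suc.prems l cd by auto
        have "wedge l = (-1) ^ length xs * wedge (c # xs @ ys)"
          using wedge_move_front[of xs c ys] sub l by simp
        also have "wedge (c # xs @ ys) = wedge ?k"
          using wedge_member[OF d sub(1)] by (simp only: wedge_add) simp
        finally have wl: "wedge l = (-1) ^ length xs * wedge ?k" .
        have "anticomm (c + d) (c + d) = anticomm c d + anticomm c d"
          using False cd by (simp add: anticomm_add_left anticomm_add_right anticomm_commute[of d c])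
        then have "anticomm (c + d) (c + d) \<noteq> 0" using cd(3) double_eq_0 by metis
        moreover have "length ?k = Suc n" using Suc.hyps(2) l by simp
        moreover have "set ?k \<subseteq> G1" using sub add_vector by simp
        ultimately have "?P ?k" by (intro pivot[of ?k "c + d"]) simp_all
        then obtain e x where e: "x \<in> G0" "set e \<subseteq> G1" "length e = length ?k"
          "sorted_wrt (\<lambda>u v. anticomm u v = 0) e" "wedge ?k = x * wedge e" "perp ?k \<subseteq> perp e"
          by blast
        have "perp l \<subseteq> perp ?k"
          using cd by (auto simp: perp_def l anticomm_add_right)
        with e(6) have "perp l \<subseteq> perp e" by blast
        moreover have "wedge l = (-1) ^ length xs * x * wedge e"
          using wl e(5) by (simp del: wedge.simps add: mult.assoc)
        moreover have "length e = length l" using e(3) l by simp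
        ultimately show ?thesis
          using e(2,4) mult_scalar[OF sign_scalar e(1)] by blast
      qed
    qed
  qed
  then show ?thesis using that by blast
qed

section \<open>Spans, duality, and linear dependence\<close>

abbreviation "sp \<equiv> list_span G0"

lemma sp_ConsI: "k \<in> G0 \<Longrightarrow> x \<in> sp l \<Longrightarrow> y = k * a + x \<Longrightarrow> y \<in> sp (a # l)"
  by auto

lemma zero_sp: "0 \<in> sp l"
  by (induction l) (auto intro: sp_ConsI[OF zero_scalar] simp del: list_span.simps(2))

lemma add_sp: "x \<in> sp l \<Longrightarrow> y \<in> sp l \<Longrightarrow> x + y \<in> sp l"
proof (induction l arbitrary: x y)
  case (Cons c l)
  then obtain j k x' y' where "j \<in> G0" "k \<in> G0" "x' \<in> sp l" "y' \<in> sp l"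
    "x = j * c + x'" "y = k * c + y'" by auto
  with Cons.IH show ?case
    by (intro sp_ConsI[of "j + k" "x' + y'"]) (auto intro: add_scalar simp: algebra_simps)
qed simp

lemma scale_sp: "k \<in> G0 \<Longrightarrow> x \<in> sp l \<Longrightarrow> k * x \<in> sp l"
proof (induction l arbitrary: x)
  case (Cons c l)
  then obtain j x' where "j \<in> G0" "x' \<in> sp l" "x = j * c + x'" by auto
  with Cons show ?case
    by (intro sp_ConsI[of "k * j" "k * x'"]) (auto intro: mult_scalar simp: algebra_simps)
qed simp

lemma sp_vector: "set l \<subseteq> G1 \<Longrightarrow> x \<in> sp l \<Longrightarrow> x \<in> G1"
  by (induction l arbitrary: x) (auto intro!: zero_vector add_vector scale_vector)

lemma sp_Cons_tail: "x \<in> sp l \<Longrightarrow> x \<in> sp (c # l)"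
  by (rule sp_ConsI[OF zero_scalar]) auto

lemma member_sp: "y \<in> set l \<Longrightarrow> y \<in> sp l"
proof (induction l)
  case (Cons c l)
  have "c \<in> sp (c # l)"
    by (rule sp_ConsI[OF one_scalar zero_sp]) simp
  with Cons sp_Cons_tail show ?case by (auto simp del: list_span.simps)
qed simp

lemma anticomm_perp_sp: "z \<in> perp l \<Longrightarrow> y \<in> sp l \<Longrightarrow> anticomm z y = 0"
proof (induction l arbitrary: y)
  case (Cons c l)
  then show ?case by (auto simp: anticomm_add_right anticomm_scale_right)
qed (simp add: anticomm_def)

lemma perp_iff_sp: "z \<in> perp l \<longleftrightarrow> (\<forall>y\<in>sp l. anticomm z y = 0)"
  using anticomm_perp_sp member_sp by (auto simp: perp_def)

text \<open>Separating \<open>l\<close> from \<open>m\<close> lets the induction shrink the span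
  while the outer product keeps all its factors.\<close>

lemma wedge_sp_eq_0:
  assumes "a \<in> sp l" "set l \<subseteq> set m" "set m \<subseteq> G1"
  shows "wedge (a # m) = 0"
  using assms
proof (induction l arbitrary: a)
  case (Cons c l)
  then obtain j x where "j \<in> G0" "x \<in> sp l" "a = j * c + x" by auto
  with Cons show ?case
    by (simp only: wedge_add wedge_scale) (simp del: wedge.simps add: wedge_member)
qed simp

text \<open>Finite-dimensional biduality for the form restricted to \<open>M\<close>.\<close>

lemma annihilator_combination:
  assumes M: "M \<subseteq> G1" "\<And>x y k. x \<in> M \<Longrightarrow> y \<in> M \<Longrightarrow> k \<in> G0 \<Longrightarrow> x + k * y \<in> M"
    and "set t \<subseteq> G1" "u \<in> G1" "\<And>x. x \<in> M \<Longrightarrow> x \<in> perp t \<Longrightarrow> anticomm x u = 0"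
  obtains w where "w \<in> sp t" "\<And>x. x \<in> M \<Longrightarrow> anticomm x (u - w) = 0"
proof -
  have "\<exists>w\<in>sp t. \<forall>x\<in>M. anticomm x (u - w) = 0"
    using assms(3-5)
  proof (induction t arbitrary: u)
    case (Cons b t)
    show ?case
    proof (cases "\<forall>x\<in>M. x \<in> perp t \<longrightarrow> anticomm x b = 0")
      case True
      then have "\<exists>w\<in>sp t. \<forall>x\<in>M. anticomm x (u - w) = 0"
        using Cons.prems by (intro Cons.IH) auto
      then show ?thesis using sp_Cons_tail by blast
    next
      case False
      then obtain z where z: "z \<in> M" "z \<in> perp t" "anticomm z b \<noteq> 0" by blast
      have b: "b \<in> G1" using Cons.prems by simp
      have sc: "anticomm x y \<in> G0" if "x \<in> M" "y \<in> G1" for x y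
        using that M by (intro anticomm_scalar) auto
      obtain i where i: "i \<in> G0" "anticomm z b * i = 1"
        using inverse_scalar[OF sc[OF z(1) b] z(3)] by blast
      \<comment> \<open>Chosen so that \<open>u - k * b\<close> is orthogonal to
        \<open>z\<close>.\<close>
      define k where "k = i * anticomm z u"
      have k: "k \<in> G0" unfolding k_def by (intro mult_scalar i sc z Cons.prems)
      have "anticomm x (u - k * b) = 0" if x: "x \<in> M" "x \<in> perp t" for x
      proof -
        \<comment> \<open>Chosen so that \<open>x + j * z\<close> is also orthogonal to
          \<open>b\<close>; the hypothesis on \<open>u\<close> then applies to it.\<close>
        define j where "j = - (i * anticomm x b)"
        have j: "j \<in> G0" unfolding j_def by (intro mult_scalar uminus_scalar i sc x b)
        have "i * anticomm x b * anticomm z b = anticomm x b"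
          by (metis i mult.assoc mult_1_right scalar_commute)
        then have "anticomm x b + j * anticomm z b = 0" by (simp add: j_def)
        then have "anticomm (x + j * z) b = 0"
          using j by (simp add: anticomm_add_left anticomm_scale_left)
        moreover have "x + j * z \<in> perp t"
          using x z j by (simp add: perp_def anticomm_add_left anticomm_scale_left)
        ultimately have "x + j * z \<in> perp (b # t)" by simp
        moreover have "x + j * z \<in> M" using M(2) x z j by blast
        ultimately have "anticomm (x + j * z) u = 0" by (rule Cons.prems(3)[rotated])
        then have "anticomm x u + j * anticomm z u = 0"
          using j by (simp add: anticomm_add_left anticomm_scale_left)
        then have "anticomm x u = i * anticomm x b * anticomm z u" by (simp add: j_def)
        also have "\<dots> = k * anticomm x b"
          unfolding k_def by (metis mult.assoc scalar_commute sc x(1) b)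
        finally show ?thesis
          using k by (simp add: anticomm_diff_right anticomm_scale_right)
      qed
      then have "\<exists>w\<in>sp t. \<forall>x\<in>M. anticomm x (u - k * b - w) = 0"
        using Cons.prems b k by (intro Cons.IH diff_vector scale_vector) auto
      then obtain w where "w \<in> sp t" "\<forall>x\<in>M. anticomm x (u - (k * b + w)) = 0"
        by (auto simp: algebra_simps)
      then show ?thesis using k by (intro bexI[of _ "k * b + w"]) auto
    qed
  qed simp
  then show ?thesis using that by blast
qed

text \<open>If the product vanishes, multiplying by any vector \<open>x\<close> orthogonal to
  \<open>l\<close> leaves only the contraction, so \<open>x\<close> is orthogonal to
  \<open>a\<close>. Duality then yields \<open>w\<close> in the span with \<open>a - w\<close>
  orthogonal to all vectors, and nondegeneracy gives \<open>a = w\<close>.\<close>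

lemma wedge_Cons_eq_0_iff:
  assumes "set l \<subseteq> G1" "wedge l \<noteq> 0" "a \<in> G1"
  shows "wedge (a # l) = 0 \<longleftrightarrow> a \<in> sp l"
proof
  assume 0: "wedge (a # l) = 0"
  have "anticomm x a = 0" if x: "x \<in> G1" "x \<in> perp l" for x
  proof (rule ccontr)
    assume n: "anticomm x a \<noteq> 0"
    have "wedge (x # a # l) = x * wedge (a # l) + (-1) ^ length (a # l) * wedge (a # l) * x"
      by (rule wedge.simps)
    then have "2 * (anticomm x a * wedge l) = 0"
      using wedge_contract[OF x(1) assms(3) x(2)] 0 by (simp del: wedge.simps add: mult.assoc)
    then show False
      using assms(2) n scalar_no_zero_div two_scalar two_nonzero anticomm_scalar[OF x(1) assms(3)]
      by metis
  qed
  then obtain w where w: "w \<in> sp l" "\<And>x. x \<in> G1 \<Longrightarrow> anticomm x (a - w) = 0"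
    using annihilator_combination[of G1 l a] assms add_vector scale_vector by blast
  have "a - w = 0"
    using w assms sp_vector
    by (intro nondegenerate diff_vector) (auto simp: orthogonal_iff anticomm_commute)
  with w show "a \<in> sp l" by simp
next
  assume "a \<in> sp l"
  then show "wedge (a # l) = 0" using wedge_sp_eq_0 assms(1) by blast
qed

text \<open>The span is recoverable from the outer product, as the set of vectors that annihilate
  it.\<close>

lemma sp_cong_wedge:
  assumes "set l \<subseteq> G1" "set m \<subseteq> G1" "length l = length m" "wedge l = e * wedge m" "e \<in> G0" "wedge l \<noteq> 0"
  shows "sp l = sp m"
proof -
  have "wedge m \<noteq> 0" "e \<noteq> 0" using assms by auto
  have "a \<in> sp l \<longleftrightarrow> a \<in> sp m" if "a \<in> G1" for a
  proof -
    have "wedge (a # l) = e * wedge (a # m)" using assms by (intro wedge_Cons_scale)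
    then have "wedge (a # l) = 0 \<longleftrightarrow> wedge (a # m) = 0"
      using scalar_no_zero_div[OF assms(5) \<open>e \<noteq> 0\<close>] by (auto simp del: wedge.simps)
    then show ?thesis
      using wedge_Cons_eq_0_iff that assms \<open>wedge m \<noteq> 0\<close> by blast
  qed
  then show ?thesis using sp_vector assms(1,2) by blast
qed

text \<open>Either the contraction vanishes, or a basis adapted to \<open>a\<close> exhibits it as a
  nonzero multiple of \<open>wedge m1\<close>.\<close>

lemma vector_mult_wedge_cases:
  assumes "a \<in> G1" "set m \<subseteq> G1"
  obtains (perp) "a \<in> perp m" "2 * (a * wedge m) = wedge (a # m)"
  | (contract) c m1 e k where "c \<in> set m" "anticomm a c \<noteq> 0" "set m1 \<subseteq> G1"
      "length m = Suc (length m1)" "a \<in> perp m1" "e \<in> G0" "wedge m = e * wedge (c # m1)"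
      "k \<in> G0" "k \<noteq> 0" "2 * (a * wedge m) = wedge (a # m) + k * wedge m1"
proof (cases "a \<in> perp m")
  case True
  then show ?thesis by (metis perp wedge_orthogonal_Cons)
next
  case False
  then obtain c where c: "c \<in> set m" "anticomm a c \<noteq> 0" by (auto simp: perp_def)
  obtain m1 e where m1: "e \<in> G0" "e \<noteq> 0" "set m1 \<subseteq> G1" "length m = Suc (length m1)"
    "a \<in> perp m1" "wedge m = e * wedge (c # m1)"
    using wedge_adapt[OF assms c] by metis
  have cv: "c \<in> G1" using c assms by auto
  let ?k = "e * (2 * anticomm a c)"
  have "wedge (a # m) = e * wedge (a # c # m1)"
    using m1 by (intro wedge_Cons_scale) auto
  moreover have "2 * (a * wedge m) = e * (2 * (a * wedge (c # m1)))"
    unfolding m1(6) using scalar_left_commute m1(1) by metis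
  ultimately have "2 * (a * wedge m) = wedge (a # m) + ?k * wedge m1"
    unfolding wedge_contract[OF assms(1) cv m1(5)] by (simp only: distrib_left mult.assoc)
  moreover have "?k \<in> G0" "?k \<noteq> 0"
    using m1 c two_nonzero two_scalar scalar_no_zero_div anticomm_scalar[OF assms(1) cv] mult_scalar
    by metis+
  ultimately show ?thesis using contract c m1 by blast
qed

section \<open>Blades as scalar multiples of outer products\<close>

text \<open>For two or more factors the scalar is absorbed into the first one, which preserves
  orthogonality.\<close>

lemma scale_blade: "x \<in> G0 \<Longrightarrow> b \<in> blades G0 G1 r \<Longrightarrow> x * b \<in> blades G0 G1 r"
proof -
  assume x: "x \<in> G0" and b: "b \<in> blades G0 G1 r"
  consider "r = 0" | "r = 1" | "r \<ge> 2" by linarith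
  then show ?thesis
  proof cases
    case 3
    then obtain vs where vs: "b = prod_list vs" "length vs = r" "set vs \<subseteq> G1"
      "\<forall>i<r. \<forall>j<r. i \<noteq> j \<longrightarrow> anticomm (vs ! i) (vs ! j) = 0"
      using b by (auto simp: blades_def orthogonal_iff)
    then obtain v ws where v: "vs = v # ws" using 3 by (cases vs) auto
    have "\<forall>i<r. \<forall>j<r. i \<noteq> j \<longrightarrow> anticomm (((x * v) # ws) ! i) (((x * v) # ws) ! j) = 0"
    proof (intro allI impI)
      fix i j assume "i < r" "j < r" "i \<noteq> j"
      with vs(4) have "anticomm (vs ! i) (vs ! j) = 0" by blast
      with x \<open>i \<noteq> j\<close> show "anticomm (((x * v) # ws) ! i) (((x * v) # ws) ! j) = 0"
        by (cases i; cases j) (simp_all add: v anticomm_scale_left anticomm_scale_right)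
    qed
    moreover have "x * b = prod_list ((x * v) # ws)" by (simp add: vs(1) v mult.assoc)
    ultimately show ?thesis
      using 3 vs v x scale_vector
      by (auto simp: blades_def orthogonal_iff intro!: exI[of _ "(x * v) # ws"])
  qed (use x b in \<open>auto simp: blades_def mult_scalar scale_vector\<close>)
qed

lemma prod_list_blade:
  assumes "sorted_wrt (\<lambda>u v. anticomm u v = 0) e" "set e \<subseteq> G1"
  shows "prod_list e \<in> blades G0 G1 (length e)"
proof -
  have "anticomm (e ! i) (e ! j) = 0" if "i < length e" "j < length e" "i \<noteq> j" for i j
    using that
  proof (cases "i < j")
    case False
    with that have "anticomm (e ! j) (e ! i) = 0"
      using assms(1) by (simp add: sorted_wrt_iff_nth_less)
    then show ?thesis by (subst anticomm_commute)
  qed (use assms(1) in \<open>simp add: sorted_wrt_iff_nth_less\<close>)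
  moreover have "prod_list e \<in> G1" if "length e = 1"
    using assms(2) that by (auto simp: length_Suc_conv)
  ultimately show ?thesis
    using assms(2) one_scalar by (auto simp: blades_def orthogonal_iff)
qed

lemma blade_prod_listE:
  assumes "b \<in> blades G0 G1 r" "r \<ge> 1"
  obtains l where "length l = r" "set l \<subseteq> G1" "sorted_wrt (\<lambda>u v. anticomm u v = 0) l" "b = prod_list l"
proof (cases "r = 1")
  case True
  with assms that[of "[b]"] show ?thesis by (auto simp: blades_def)
next
  case False
  with assms that show ?thesis
    by (auto simp: blades_def orthogonal_iff sorted_wrt_iff_nth_less)
qed

lemma power_scalar: "x \<in> G0 \<Longrightarrow> x ^ n \<in> G0"
  by (induction n) (auto intro: one_scalar mult_scalar)

lemma wedge_blade: "set l \<subseteq> G1 \<Longrightarrow> wedge l \<in> blades G0 G1 (length l)"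
proof -
  assume "set l \<subseteq> G1"
  then obtain e c where e: "c \<in> G0" "set e \<subseteq> G1" "length e = length l"
    "sorted_wrt (\<lambda>u v. anticomm u v = 0) e" "wedge l = c * wedge e"
    using wedge_orthogonalize by metis
  then have "wedge l = (c * 2 ^ length l) * prod_list e"
    by (simp add: wedge_eq_prod_list mult.assoc)
  then show ?thesis
    using scale_blade prod_list_blade mult_scalar power_scalar two_scalar e by metis
qed

lemma prod_list_eq_wedge:
  assumes "sorted_wrt (\<lambda>u v. anticomm u v = 0) l"
  shows "prod_list l = half G0 ^ length l * wedge l"
proof -
  have "half G0 ^ n * 2 ^ n = 1" for n :: nat
  proof (induction n)
    case (Suc n)
    have "half G0 ^ Suc n * 2 ^ Suc n = half G0 ^ n * (half G0 * (2 * 2 ^ n))"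
      by (simp only: power_Suc2[of "half G0"] power_Suc[of 2] mult.assoc)
    with Suc show ?case by (simp only: half_two)
  qed simp
  then show ?thesis
    unfolding wedge_eq_prod_list[OF assms] by (metis mult.assoc mult_1)
qed

text \<open>The scalar \<open>k\<close> covers grade 0, where \<open>wedge []\<close> is 1, and
  absorbs the powers of two in the other grades.\<close>

lemma blade_eq_wedgeE:
  assumes "b \<in> blades G0 G1 r"
  obtains l k where "length l = r" "set l \<subseteq> G1" "k \<in> G0" "b = k * wedge l"
proof (cases "r = 0")
  case True
  with assms that[of "[]" b] show ?thesis by (simp add: blades_def)
next
  case False
  with assms obtain l where "length l = r" "set l \<subseteq> G1"
    "sorted_wrt (\<lambda>u v. anticomm u v = 0) l" "b = prod_list l"
    by (elim blade_prod_listE) auto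
  then show ?thesis
    using that[of l "half G0 ^ r"] prod_list_eq_wedge power_scalar half_scalar by metis
qed

section \<open>Homogeneous parts and the filtration by lowest grade\<close>

lemma blade_rvecs: "b \<in> blades G0 G1 r \<Longrightarrow> b \<in> rvecs r"
  by (auto simp: rvectors_def intro!: exI[of _ "[b]"])

lemma zero_rvecs: "0 \<in> rvecs r"
  by (auto simp: rvectors_def intro!: exI[of _ "[]"])

lemma add_rvecs: "x \<in> rvecs r \<Longrightarrow> y \<in> rvecs r \<Longrightarrow> x + y \<in> rvecs r"
proof -
  assume "x \<in> rvecs r" "y \<in> rvecs r"
  then obtain bs cs where "x = sum_list bs" "set bs \<subseteq> blades G0 G1 r"
    "y = sum_list cs" "set cs \<subseteq> blades G0 G1 r" by (auto simp: rvectors_def)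
  then show ?thesis by (auto simp: rvectors_def intro!: exI[of _ "bs @ cs"])
qed

lemma scale_rvecs: "k \<in> G0 \<Longrightarrow> x \<in> rvecs r \<Longrightarrow> k * x \<in> rvecs r"
proof -
  assume k: "k \<in> G0" and "x \<in> rvecs r"
  then obtain bs where bs: "x = sum_list bs" "set bs \<subseteq> blades G0 G1 r"
    by (auto simp: rvectors_def)
  have "k * x = sum_list (map ((*) k) bs)" unfolding bs by (simp add: sum_list_const_mult)
  moreover have "set (map ((*) k) bs) \<subseteq> blades G0 G1 r" using bs k scale_blade by auto
  ultimately show ?thesis unfolding rvectors_def by blast
qed

lemma wedge_rvecs: "k \<in> G0 \<Longrightarrow> set l \<subseteq> G1 \<Longrightarrow> k * wedge l \<in> rvecs (length l)"
  by (intro scale_rvecs blade_rvecs wedge_blade)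

lemma hp_rvecs: "x \<in> rvecs r \<Longrightarrow> hp x = (\<lambda>i. if i = r then x else 0)"
proof (rule hp_eqI)
  assume x: "x \<in> rvecs r"
  show "grade_decomp G0 G1 x (\<lambda>i. if i = r then x else 0)"
    unfolding grade_decomp_def using x zero_rvecs by (cases "x = 0") auto
qed

lemma hp_zero: "hp 0 i = 0"
  using hp_rvecs[OF zero_rvecs[of 0]] by simp

lemma hp_add: "hp (x + y) i = hp x i + hp y i"
proof -
  \<comment> \<open>Parts may cancel, so the sums are compared over the union of the two
    supports.\<close>
  let ?S = "{i. hp x i \<noteq> 0} \<union> {i. hp y i \<noteq> 0}" and ?f = "\<lambda>i. hp x i + hp y i"
  have fin: "finite ?S" by (simp add: finite_hp)
  have sub: "{i. ?f i \<noteq> 0} \<subseteq> ?S" by auto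
  have "(\<Sum>i | ?f i \<noteq> 0. ?f i) = (\<Sum>i\<in>?S. ?f i)"
    by (rule sum.mono_neutral_left[OF fin sub]) auto
  also have "\<dots> = (\<Sum>i\<in>?S. hp x i) + (\<Sum>i\<in>?S. hp y i)" by (rule sum.distrib)
  also have "(\<Sum>i\<in>?S. hp x i) = (\<Sum>i | hp x i \<noteq> 0. hp x i)"
    by (rule sum.mono_neutral_right[OF fin]) auto
  also have "(\<Sum>i\<in>?S. hp y i) = (\<Sum>i | hp y i \<noteq> 0. hp y i)"
    by (rule sum.mono_neutral_right[OF fin]) auto
  finally have "x + y = (\<Sum>i | ?f i \<noteq> 0. ?f i)" by (simp only: sum_hp)
  then have "grade_decomp G0 G1 (x + y) ?f"
    unfolding grade_decomp_def using finite_subset[OF sub fin] hp_in_rvecs add_rvecs by blast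
  then have "hp (x + y) = ?f" by (rule hp_eqI)
  then show ?thesis by simp
qed

lemma hp_scale:
  assumes "k \<in> G0" shows "hp (k * x) i = k * hp x i"
proof -
  have sub: "{i. k * hp x i \<noteq> 0} \<subseteq> {i. hp x i \<noteq> 0}" by auto
  have "k * x = (\<Sum>i | hp x i \<noteq> 0. k * hp x i)"
    by (simp only: sum_distrib_left[symmetric] sum_hp)
  also have "\<dots> = (\<Sum>i | k * hp x i \<noteq> 0. k * hp x i)"
    by (rule sum.mono_neutral_right[OF finite_hp sub]) auto
  finally have "grade_decomp G0 G1 (k * x) (\<lambda>i. k * hp x i)"
    unfolding grade_decomp_def
    using finite_subset[OF sub finite_hp] hp_in_rvecs scale_rvecs[OF assms] by blast
  then have "hp (k * x) = (\<lambda>i. k * hp x i)" by (rule hp_eqI)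
  then show ?thesis by simp
qed

text \<open>The bound is an integer because \<open>s - r\<close> may be negative; for a bound of at
  most 0 this is the whole ring.\<close>

definition grades_from :: "int \<Rightarrow> 'a set" where
  "grades_from k = {x. \<forall>j. int j < k \<longrightarrow> hp x j = 0}"

lemma zero_grades_from: "0 \<in> grades_from k"
  and add_grades_from: "x \<in> grades_from k \<Longrightarrow> y \<in> grades_from k \<Longrightarrow> x + y \<in> grades_from k"
  and scale_grades_from: "c \<in> G0 \<Longrightarrow> x \<in> grades_from k \<Longrightarrow> c * x \<in> grades_from k"
  by (auto simp: grades_from_def hp_zero hp_add hp_scale)

lemma rvecs_grades_from: "x \<in> rvecs j \<Longrightarrow> k \<le> int j \<Longrightarrow> x \<in> grades_from k"
  by (auto simp: grades_from_def hp_rvecs)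

text \<open>Here \<open>y\<close> is twice the contraction: it is zero or homogeneous of grade one
  below that of \<open>wedge l\<close>.\<close>

lemma vector_mult_wedge_grades:
  assumes "a \<in> G1" "set l \<subseteq> G1"
  obtains y where "y \<in> grades_from (int (length l) - 1)" "hp y (Suc (length l)) = 0"
    "a * wedge l = half G0 * wedge (a # l) + half G0 * y"
  using assms
proof (cases rule: vector_mult_wedge_cases)
  case perp
  then show ?thesis using that[of 0] half_two[of "a * wedge l"] by (simp add: zero_grades_from hp_zero)
next
  case (contract c m1 e k)
  then have "k * wedge m1 \<in> rvecs (length m1)" by (intro wedge_rvecs)
  moreover have "a * wedge l = half G0 * wedge (a # l) + half G0 * (k * wedge m1)"
    using half_two[of "a * wedge l"] contract(10) by (simp only: distrib_left)
  ultimately show ?thesis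
    using that[of "k * wedge m1"] contract(4)
    by (simp add: rvecs_grades_from hp_rvecs del: wedge.simps)
qed

lemma vector_mult_rvecs:
  assumes a: "a \<in> G1" and "x \<in> rvecs j"
  shows "a * x \<in> grades_from (int j - 1)"
proof -
  have blade: "a * b \<in> grades_from (int j - 1)" if b: "b \<in> blades G0 G1 j" for b
  proof -
    obtain l k where l: "length l = j" "set l \<subseteq> G1" "k \<in> G0" "b = k * wedge l"
      using blade_eq_wedgeE[OF b] by blast
    obtain y where y: "y \<in> grades_from (int j - 1)"
      "a * wedge l = half G0 * wedge (a # l) + half G0 * y"
      using vector_mult_wedge_grades[OF a l(2)] l(1) by metis
    have "wedge (a # l) \<in> grades_from (int j - 1)"
      using l a by (intro rvecs_grades_from[OF blade_rvecs[OF wedge_blade]]) auto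
    with y have "a * wedge l \<in> grades_from (int j - 1)"
      by (simp del: wedge.simps add: add_grades_from scale_grades_from half_scalar)
    then have "k * (a * wedge l) \<in> grades_from (int j - 1)"
      by (rule scale_grades_from[OF l(3)])
    then show ?thesis using l by (metis scalar_left_commute)
  qed
  obtain bs where "x = sum_list bs" "set bs \<subseteq> blades G0 G1 j"
    using assms(2) by (auto simp: rvectors_def)
  then show ?thesis
    by (induction bs arbitrary: x) (auto simp: distrib_left zero_grades_from intro!: add_grades_from blade)
qed

text \<open>A vector lowers each homogeneous part by at most one grade.\<close>

lemma vector_mult_grades_from:
  assumes a: "a \<in> G1" and x: "x \<in> grades_from (k + 1)"
  shows "a * x \<in> grades_from k"
proof -
  have part: "a * hp x j \<in> grades_from k" for j
  proof (cases "int j < k + 1")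
    case True
    with x show ?thesis by (simp add: grades_from_def hp_zero)
  next
    case False
    have "a * hp x j \<in> grades_from (int j - 1)"
      by (rule vector_mult_rvecs[OF a hp_in_rvecs])
    with False show ?thesis by (auto simp: grades_from_def)
  qed
  have "(\<Sum>j\<in>S. a * hp x j) \<in> grades_from k" if "finite S" for S
    using that by induction (auto intro: zero_grades_from add_grades_from part)
  from this[OF finite_hp[of x]] show ?thesis
    by (simp only: sum_distrib_left[symmetric] sum_hp)
qed

section \<open>Products of homogeneous elements and represented subspaces\<close>

lemma support_rvecs: "x \<in> rvecs r \<Longrightarrow> x \<noteq> 0 \<Longrightarrow> {i. hp x i \<noteq> 0} = {r}"
  by (auto simp: hp_rvecs)

lemma left_inner_rvecs:
  assumes "A \<in> rvecs r" "A \<noteq> 0" "B \<in> rvecs s" "B \<noteq> 0"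
  shows "left_inner G0 G1 A B = grade_part G0 G1 (A * B) (int s - int r)"
  by (simp add: left_inner_def support_rvecs[OF assms(1,2)] support_rvecs[OF assms(3,4)])
    (simp add: hp_rvecs[OF assms(1)] hp_rvecs[OF assms(3)])

lemma outer_rvecs:
  assumes "A \<in> rvecs r" "A \<noteq> 0" "B \<in> rvecs s" "B \<noteq> 0"
  shows "outer G0 G1 A B = grade_part G0 G1 (A * B) (int r + int s)"
  by (simp add: outer_def support_rvecs[OF assms(1,2)] support_rvecs[OF assms(3,4)])
    (simp add: hp_rvecs[OF assms(1)] hp_rvecs[OF assms(3)])

text \<open>The part of \<open>a * wedge l\<close> of top grade is half of
  \<open>wedge (a # l)\<close>, so the defining condition becomes linear dependence.\<close>

lemma represented_subspace_wedge:
  assumes "k \<in> G0" "k \<noteq> 0" "set l \<subseteq> G1" "wedge l \<noteq> 0"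
  shows "represented_subspace G0 G1 (k * wedge l) = sp l"
proof -
  have nz: "k * wedge l \<noteq> 0" using assms scalar_no_zero_div by blast
  have "outer G0 G1 a (k * wedge l) = 0 \<longleftrightarrow> a \<in> sp l" if a: "a \<in> G1" for a
  proof (cases "a = 0")
    case True
    then show ?thesis by (simp add: outer_def hp_zero zero_sp)
  next
    case False
    have "a \<in> rvecs 1" using a by (intro blade_rvecs) (simp add: blades_def)
    then have "outer G0 G1 a (k * wedge l) = hp (a * (k * wedge l)) (Suc (length l))"
      using outer_rvecs[OF _ False wedge_rvecs[OF assms(1,3)] nz]
      by (simp add: grade_part_def nat_add_distrib)
    also have "\<dots> = k * hp (a * wedge l) (Suc (length l))"
      using assms(1) by (simp only: scalar_left_commute[of k a] hp_scale)
    also have "hp (a * wedge l) (Suc (length l)) = half G0 * wedge (a # l)"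
    proof -
      obtain y where "hp y (Suc (length l)) = 0" "a * wedge l = half G0 * wedge (a # l) + half G0 * y"
        using vector_mult_wedge_grades[OF a assms(3)] by metis
      moreover have "hp (wedge (a # l)) (Suc (length l)) = wedge (a # l)"
        using wedge_blade[of "a # l"] a assms(3) by (simp del: wedge.simps add: hp_rvecs[OF blade_rvecs])
      ultimately show ?thesis
        by (simp del: wedge.simps add: hp_add hp_scale half_scalar)
    qed
    finally have "outer G0 G1 a (k * wedge l) = 0 \<longleftrightarrow> wedge (a # l) = 0"
      using scalar_no_zero_div[OF assms(1,2)] scalar_no_zero_div[OF half_scalar half_nonzero]
      by (metis mult_zero_right)
    with wedge_Cons_eq_0_iff[OF assms(3,4) a] show ?thesis by blast
  qed
  with sp_vector[OF assms(3)] show ?thesis by (auto simp: represented_subspace_def)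
qed

section \<open>The lowest possible grade of a product of blades\<close>

text \<open>
  Multiplying by one vector of \<open>l\<close> at a time, only the contraction can contribute to the lowest
  possible grade; a vector \<open>b\<close> that contracts the current blade to zero agrees on the span of \<open>m\<close> with
  a combination of the vectors already used.
\<close>

lemma prod_list_mult_wedge_cases:
  assumes "set l \<subseteq> G1" "set m \<subseteq> G1" "wedge l \<noteq> 0" "wedge m \<noteq> 0"
  obtains (degenerate) a where "a \<in> sp l" "a \<noteq> 0" "a \<in> perp m"
      "prod_list l * wedge m \<in> grades_from (int (length m) - int (length l) + 1)"
  | (nondegenerate) m' k y where "\<And>a. a \<in> sp l \<Longrightarrow> a \<in> perp m \<Longrightarrow> a = 0"
      "k \<in> G0" "k \<noteq> 0" "set m' \<subseteq> G1" "wedge m' \<noteq> 0" "length m' + length l = length m"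
      "sp m' = sp m \<inter> perp l" "prod_list l * wedge m = k * wedge m' + y"
      "y \<in> grades_from (int (length m) - int (length l) + 1)"
proof -
  let ?D = "\<lambda>l. \<exists>a. a \<in> sp l \<and> a \<noteq> 0 \<and> a \<in> perp m \<and>
    prod_list l * wedge m \<in> grades_from (int (length m) - int (length l) + 1)"
  let ?N = "\<lambda>l. (\<forall>a. a \<in> sp l \<longrightarrow> a \<in> perp m \<longrightarrow> a = 0) \<and> (\<exists>m' k y. k \<in> G0 \<and> k \<noteq> 0 \<and>
    set m' \<subseteq> G1 \<and> wedge m' \<noteq> 0 \<and> length m' + length l = length m \<and> sp m' = sp m \<inter> perp l \<and>
    prod_list l * wedge m = k * wedge m' + y \<and>
    y \<in> grades_from (int (length m) - int (length l) + 1))"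
  have "?D l \<or> ?N l"
    using assms(1,3)
  proof (induction l)
    case Nil
    show ?case
      using assms(2,4) one_scalar
      by (intro disjI2 conjI exI[of _ m] exI[of _ 1] exI[of _ 0]) (simp_all add: zero_grades_from)
  next
    case (Cons b l)
    have b: "b \<in> G1" and l: "set l \<subseteq> G1" using Cons.prems by auto
    have "wedge l \<noteq> 0" using Cons.prems(2) by auto
    then have bl: "b \<notin> sp l" using wedge_sp_eq_0[of b l l] Cons.prems by auto
    from Cons.IH[OF l \<open>wedge l \<noteq> 0\<close>] show ?case
    proof
      assume "?D l"
      then obtain a where a: "a \<in> sp l" "a \<noteq> 0" "a \<in> perp m"
        "prod_list l * wedge m \<in> grades_from (int (length m) - int (length l) + 1)" by blast
      \<comment> \<open>Once the leading part is lost it stays lost: another factor lowers the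
        grades and the required bound by one alike.\<close>
      from vector_mult_grades_from[OF b a(4)]
      have "prod_list (b # l) * wedge m \<in> grades_from (int (length m) - int (length (b # l)) + 1)"
        by (simp add: mult.assoc)
      with a sp_Cons_tail have "?D (b # l)" by blast
      then show ?thesis by blast
    next
      assume "?N l"
      then obtain m' k y where inj: "\<And>a. a \<in> sp l \<Longrightarrow> a \<in> perp m \<Longrightarrow> a = 0"
        and m': "k \<in> G0" "k \<noteq> 0" "set m' \<subseteq> G1" "wedge m' \<noteq> 0" "length m' + length l = length m"
          "sp m' = sp m \<inter> perp l" "prod_list l * wedge m = k * wedge m' + y"
          "y \<in> grades_from (int (length m) - int (length l) + 1)" by blast
      let ?g = "grades_from (int (length m) - int (length (b # l)) + 1)"
      have by_g: "b * y \<in> ?g" using vector_mult_grades_from[OF b m'(8)] by simp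
      \<comment> \<open>The outer part lies two grades above a contraction of
        \<open>wedge m'\<close> by \<open>b\<close>, so it belongs to the remainder.\<close>
      have "int (length (b # m')) = int (length m) - int (length (b # l)) + 2" using m'(5) by simp
      then have w: "c * wedge (b # m') \<in> ?g" if "c \<in> G0" for c
        using rvecs_grades_from[OF wedge_rvecs[OF that, of "b # m'"]] b m'(3)
        by (simp del: wedge.simps)
      have kh: "k * half G0 \<in> G0" using m' half_scalar mult_scalar by blast
      have "b * (k * wedge m') = k * (half G0 * (2 * (b * wedge m')))"
        using m'(1) by (simp only: half_two scalar_left_commute[of k b])
      then have bk: "prod_list (b # l) * wedge m = k * half G0 * (2 * (b * wedge m')) + b * y"
        using m'(7) by (simp add: mult.assoc distrib_left)
      show ?thesis
        using b m'(3)
      proof (cases rule: vector_mult_wedge_cases)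
        case perp
        \<comment> \<open>Since \<open>sp m'\<close> is the part of \<open>sp m\<close> orthogonal
          to \<open>l\<close>, duality with \<open>sp m\<close> as \<open>M\<close> corrects
          \<open>b\<close> by some \<open>w\<close> in \<open>sp l\<close> to a vector orthogonal to
          all of \<open>m\<close>. It is nonzero because \<open>b\<close> is not in
          \<open>sp l\<close>.\<close>
        have "anticomm x b = 0" if "x \<in> sp m" "x \<in> perp l" for x
        proof -
          have "anticomm b x = 0" using that m'(6) by (intro anticomm_perp_sp[OF perp(1)]) simp
          then show ?thesis by (subst anticomm_commute)
        qed
        then obtain w where w': "w \<in> sp l" "\<And>x. x \<in> sp m \<Longrightarrow> anticomm x (b - w) = 0"
          using sp_vector[OF assms(2)] add_sp scale_sp b l
          by (elim annihilator_combination[of "sp m" l b, rotated -1]) auto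
        have "- w \<in> sp l" using scale_sp[OF uminus_scalar[OF one_scalar] w'(1)] by simp
        then have "b - w \<in> sp (b # l)" by (rule sp_ConsI[OF one_scalar]) simp
        moreover have "b - w \<noteq> 0" using bl w'(1) by auto
        moreover have "b - w \<in> perp m" using w'(2) by (auto simp: perp_iff_sp anticomm_commute)
        moreover have "prod_list (b # l) * wedge m \<in> ?g"
          unfolding bk perp(2) by (intro add_grades_from w kh by_g)
        ultimately have "?D (b # l)" by blast
        then show ?thesis by blast
      next
        case (contract c m1 e j)
        have c: "c \<in> sp m" "c \<in> perp l" "c \<in> G1"
          using member_sp[OF contract(1)] m'(3,6) contract(1) by auto
        have m1: "wedge (c # m1) \<noteq> 0" using contract(7) m'(4) by auto
        have spc: "sp m' = sp (c # m1)"
          using contract m' c by (intro sp_cong_wedge[of _ _ e]) auto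
        \<comment> \<open>The vector \<open>c\<close> lies in \<open>sp m\<close> and is orthogonal
          to \<open>l\<close> but not to \<open>b\<close>, so pairing with it isolates the
          coefficient of \<open>b\<close>.\<close>
        have "a = 0" if a: "a \<in> sp (b # l)" "a \<in> perp m" for a
        proof -
          obtain i z where z: "i \<in> G0" "z \<in> sp l" "a = i * b + z" using a(1) by auto
          have "anticomm a c = 0" using anticomm_perp_sp[OF a(2) c(1)] .
          moreover have "anticomm z c = 0" using anticomm_perp_sp[OF c(2) z(2)] anticomm_commute by metis
          ultimately have "i * anticomm b c = 0" using z by (simp add: anticomm_add_left anticomm_scale_left)
          then have "i = 0" using scalar_no_zero_div z(1) contract(2) by blast
          then show "a = 0" using inj z a(2) by simp
        qed
        moreover have "wedge m1 \<noteq> 0" using m1 by auto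
        moreover have "length m1 + length (b # l) = length m" using contract(4) m'(5) by simp
        moreover have "sp m1 = sp m \<inter> perp (b # l)"
        proof -
          \<comment> \<open>In the basis \<open>c # m1\<close> only \<open>c\<close> pairs
            nontrivially with \<open>b\<close>, so orthogonality to \<open>b\<close> forces the
            coefficient of \<open>c\<close> to be 0.\<close>
          have "x \<in> sp m1 \<longleftrightarrow> x \<in> sp m' \<and> anticomm b x = 0" for x
            unfolding spc
          proof
            assume "x \<in> sp m1"
            then show "x \<in> sp (c # m1) \<and> anticomm b x = 0"
              using sp_Cons_tail anticomm_perp_sp[OF contract(5)] by blast
          next
            assume x: "x \<in> sp (c # m1) \<and> anticomm b x = 0"
            then obtain i z where z: "i \<in> G0" "z \<in> sp m1" "x = i * c + z" by auto
            with x have "i * anticomm b c = 0"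
              using anticomm_perp_sp[OF contract(5) z(2)]
              by (simp add: anticomm_add_right anticomm_scale_right)
            then have "i = 0" using scalar_no_zero_div z(1) contract(2) by blast
            with z show "x \<in> sp m1" by simp
          qed
          then show ?thesis
            unfolding m'(6) by (simp add: set_eq_iff anticomm_commute[of _ b] conj_ac)
        qed
        \<comment> \<open>The contraction becomes the new leading term; the outer part joins the
          remainder.\<close>
        moreover have "prod_list (b # l) * wedge m
            = (k * half G0 * j) * wedge m1 + (k * half G0 * wedge (b # m') + b * y)"
          unfolding bk contract(10) by (simp only: distrib_left mult.assoc add.assoc add.commute add.left_commute)
        moreover have "k * half G0 * wedge (b # m') + b * y \<in> ?g"
          by (intro add_grades_from w kh by_g)
        moreover have "k * half G0 \<noteq> 0"
          using scalar_no_zero_div[OF m'(1,2)] half_nonzero by blast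
        then have "k * half G0 * j \<noteq> 0"
          using scalar_no_zero_div[OF kh] contract(9) by blast
        moreover have "k * half G0 * j \<in> G0"
          by (rule mult_scalar[OF kh contract(8)])
        ultimately have "?N (b # l)" using contract(3) by blast
        then show ?thesis by blast
      qed
    qed
  qed
  then show ?thesis
  proof
    assume "?D l" with degenerate show ?thesis by blast
  next
    assume "?N l" with nondegenerate show ?thesis by blast
  qed
qed

end

section \<open>Both statements about the left inner product\<close>

theorem theorem16:
  fixes G0 G1 :: "'a::ring_1 set" and A B :: 'a and r s :: nat
  assumes "geometric_algebra G0 G1"
    and "r \<ge> 1" and "s \<ge> 1"
    and "A \<in> blades G0 G1 r" and "A \<noteq> 0"
    and "B \<in> blades G0 G1 s" and "B \<noteq> 0"
  shows "(left_inner G0 G1 A B = 0 \<longleftrightarrow>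
           (\<exists>a\<in>represented_subspace G0 G1 A. a \<noteq> 0 \<and>
             (\<forall>b\<in>represented_subspace G0 G1 B. orthogonal_vecs G0 a b))) \<and>
         (r < s \<and> left_inner G0 G1 A B \<noteq> 0 \<longrightarrow>
           left_inner G0 G1 A B \<in> blades G0 G1 (s - r) \<and>
           represented_subspace G0 G1 (left_inner G0 G1 A B) = orth_complement_in G0 G1 A B)"
proof -
  interpret geometric_algebra G0 G1 by fact
  obtain l where l: "length l = r" "set l \<subseteq> G1"
    "sorted_wrt (\<lambda>u v. anticomm u v = 0) l" "A = prod_list l"
    using blade_prod_listE[OF assms(4,2)] by blast
  define h where "h = half G0 ^ r"
  have A: "A = h * wedge l" "h \<in> G0" using l prod_list_eq_wedge half_scalar power_scalar by (auto simp: h_def)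
  obtain m c where m: "length m = s" "set m \<subseteq> G1" "c \<in> G0" "B = c * wedge m"
    using blade_eq_wedgeE[OF assms(6)] by blast
  have nz: "wedge l \<noteq> 0" "wedge m \<noteq> 0" "h \<noteq> 0" "c \<noteq> 0" using assms(5,7) A m by auto
  have repA: "represented_subspace G0 G1 A = sp l"
    unfolding A(1) by (rule represented_subspace_wedge) (use A l nz in auto)
  have repB: "represented_subspace G0 G1 B = sp m"
    unfolding m(4) by (rule represented_subspace_wedge) (use m nz in auto)
  have perp: "(\<forall>b\<in>sp k. orthogonal_vecs G0 a b) \<longleftrightarrow> a \<in> perp k" for a k
    by (simp add: orthogonal_iff perp_iff_sp)
  have "A * B = c * (prod_list l * wedge m)"
    using m(3) by (simp only: l(4) m(4) scalar_left_commute[of c])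
  then have L: "left_inner G0 G1 A B = c * grade_part G0 G1 (prod_list l * wedge m) (int s - int r)"
    using left_inner_rvecs[OF blade_rvecs[OF assms(4)] assms(5) blade_rvecs[OF assms(6)] assms(7)] m(3)
    by (simp add: grade_part_def hp_scale)
  show ?thesis
    using l(2) m(2) nz(1,2)
  proof (cases rule: prod_list_mult_wedge_cases)
    case (degenerate a)
    \<comment> \<open>Grade \<open>s - r\<close> lies just below the bound on the product; if it is
      negative, \<open>grade_part\<close> is 0 by convention.\<close>
    then have "left_inner G0 G1 A B = 0"
      by (auto simp: L grade_part_def grades_from_def l(1) m(1))
    with degenerate show ?thesis by (auto simp: repA repB perp)
  next
    case (nondegenerate m' k y)
    \<comment> \<open>The lengths force \<open>r\<close> to be at most \<open>s\<close>, so the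
      grade is not truncated. For \<open>r = s\<close> the list \<open>m'\<close> is empty and the
      result is a nonzero scalar.\<close>
    have len: "nat (int s - int r) = length m'" "\<not> s < r"
      using nondegenerate(6) l(1) m(1) by auto
    have "hp y (length m') = 0"
      using nondegenerate(6,9) l(1) m(1) by (auto simp: grades_from_def)
    then have L: "left_inner G0 G1 A B = (c * k) * wedge m'"
      using hp_rvecs[OF wedge_rvecs[OF nondegenerate(2,4)]]
      by (simp add: L grade_part_def len nondegenerate(8) hp_add mult.assoc)
    have ck: "c * k \<in> G0" "c * k \<noteq> 0"
      using m(3) nz(4) nondegenerate(2,3) mult_scalar scalar_no_zero_div by blast+
    then have "left_inner G0 G1 A B \<noteq> 0"
      unfolding L using nondegenerate(5) scalar_no_zero_div by blast
    moreover have "\<not> (\<exists>a\<in>sp l. a \<noteq> 0 \<and> a \<in> perp m)" using nondegenerate(1) by blast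
    moreover have "left_inner G0 G1 A B \<in> blades G0 G1 (s - r)"
      using scale_blade[OF ck(1) wedge_blade[OF nondegenerate(4)]] nondegenerate(6) l(1) m(1)
      unfolding L by auto
    moreover have "represented_subspace G0 G1 (left_inner G0 G1 A B) = orth_complement_in G0 G1 A B"
      unfolding L represented_subspace_wedge[OF ck nondegenerate(4,5)] nondegenerate(7)
      by (auto simp: orth_complement_in_def repA repB perp)
    ultimately show ?thesis by (simp add: repA repB perp)
  qed
qed

end
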